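(* Let $n\ge2$ and let $(F,X,\mathbb{R}^n)$ be a coherent system with local semiflow $\Phi$. Then for every $x\in X$ the orbit $\gamma(x)$ is nowhere dense in $X$.
   Context: System: $(F,X,\mathbb{R}^n)$ is a system if $X\subset\mathbb{R}^n$ is nonempty and convex, the interior of $X$ in $\mathbb{R}^n$ is dense in $X$, and $F\colon X\to\mathbb{R}^n$ extends to a $C^1$ vector field on an open set containing $X$ (partial derivatives of $F$ at points of $X$ are those of the extension; they are determined by $F$). It is assumed that the maximally defined solutions in $X$, $t\mapsto\Phi_t(a)$, $t\ge0$, of $dx/dt=F(x)$, $x(0)=a\in X$, generate a local semiflow $\Phi=\{\Phi_t\}_{t\ge 0}$ in $X$: $\Phi_t\colon D_t\to X$ is continuous, $D_t\subset X$ is relatively open, $\{(t,x):x\in D_t\}$ is an open neighborhood of $\{0\}\times X$ in $[0,\infty)\times X$ on which $(t,x)\mapsto\Phi_t x$ is continuous, $\Phi_0=\mathrm{id}$, and $\Phi_t\Phi_s x=\Phi_{s+t}x$ when $x\in D_s$, $\Phi_s x\in D_t$. The orbit of $x$ is $\gamma(x)=\{\Phi_t x: t\ge 0,\ x\in D_t\}$. Interaction graph: $\Gamma(F)$ has vertex set $\{1,\dots,n\}$ and a directed edge $(j,i)$, $j\ne i$, whenever $\partial F_i/\partial x_j$ is not identically $0$ on $X$. The edge $(j,i)$ has label $+1$ if $\partial F_i/\partial x_j\ge0$ on $X$, $-1$ if $\partial F_i/\partial x_j\le 0$ on $X$, and $\theta$ otherwise. A loop is a sequence of $\mu\ge2$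 edges $(i_0,i_1),(i_1,i_2),\dots,(i_{\mu-1},i_\mu)$ with $i_\mu=i_0$; it is positive if all its edges are labeled $\pm1$ and the product of these labels is $+1$. $F$ is coherent if every loop of $\Gamma(F)$ is positive. *)

theory Defs
  imports "HOL-Analysis.Analysis"
begin

section \<open>Vector fields on convex sets and their partial derivatives\<close>

definition C1_on :: "(real^'n) set \<Rightarrow> (real^'n \<Rightarrow> real^'n) \<Rightarrow> bool" where
  "C1_on U G \<longleftrightarrow>
     (\<exists>G' :: real^'n \<Rightarrow> (real^'n) \<Rightarrow>\<^sub>L (real^'n).
        (\<forall>x\<in>U. (G has_derivative blinfun_apply (G' x)) (at x)) \<and> continuous_on U G')"

definition C1_extension ::
  "(real^'n \<Rightarrow> real^'n) \<Rightarrow> (real^'n) set \<Rightarrow> (real^'n) set \<Rightarrow> (real^'n \<Rightarrow> real^'n) \<Rightarrow> bool" where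
  "C1_extension F X U G \<longleftrightarrow> open U \<and> X \<subseteq> U \<and> C1_on U G \<and> (\<forall>x\<in>X. G x = F x)"

definition partial_deriv :: "(real^'n \<Rightarrow> real^'n) \<Rightarrow> 'n \<Rightarrow> 'n \<Rightarrow> real^'n \<Rightarrow> real" where
  "partial_deriv G i j x = deriv (\<lambda>s. G (x + s *\<^sub>R axis j 1) $ i) 0"

text \<open>The values of \<open>F\<close> outside \<open>X\<close> are irrelevant: the partial derivatives of \<open>F\<close> on \<open>X\<close> are
  those of an arbitrary \<open>C\<^sup>1\<close> extension. Lemma \<open>partial_on_eq\<close> below shows that they do not depend
  on the extension when the interior of \<open>X\<close> is dense in \<open>X\<close>.\<close>

definition partial_on ::
  "(real^'n \<Rightarrow> real^'n) \<Rightarrow> (real^'n) set \<Rightarrow> 'n \<Rightarrow> 'n \<Rightarrow> real^'n \<Rightarrow> real" where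
  "partial_on F X i j x = (THE d. \<exists>U G. C1_extension F X U G \<and> d = partial_deriv G i j x)"

lemma partial_deriv_eq:
  assumes "(G has_derivative G') (at x)"
  shows "partial_deriv G i j x = G' (axis j 1) $ i"
proof -
  have "((\<lambda>s::real. x + s *\<^sub>R axis j 1) has_derivative (\<lambda>s. s *\<^sub>R axis j 1)) (at 0)"
    by (auto intro!: derivative_eq_intros)
  moreover have "(G has_derivative G') (at (x + 0 *\<^sub>R axis j 1))"
    using assms by simp
  ultimately have "((\<lambda>s. G (x + s *\<^sub>R axis j 1)) has_derivative (\<lambda>s. G' (s *\<^sub>R axis j 1))) (at 0)"
    by (rule has_derivative_compose)
  then have "((\<lambda>s. G (x + s *\<^sub>R axis j 1) $ i) has_derivative (\<lambda>s. G' (s *\<^sub>R axis j 1) $ i)) (at 0)"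
    by (rule bounded_linear.has_derivative[OF bounded_linear_vec_nth])
  moreover have "(\<lambda>s. G' (s *\<^sub>R axis j 1) $ i) = (*) (G' (axis j 1) $ i)"
    using has_derivative_bounded_linear[OF assms]
    by (auto simp: linear_simps fun_eq_iff bounded_linear.linear linear_scale)
  ultimately have "((\<lambda>s. G (x + s *\<^sub>R axis j 1) $ i) has_field_derivative (G' (axis j 1) $ i)) (at 0)"
    by (simp add: has_field_derivative_def)
  then show ?thesis
    unfolding partial_deriv_def by (rule DERIV_imp_deriv)
qed

lemma continuous_on_partial_deriv:
  fixes G :: "real^'n \<Rightarrow> real^'n"
  assumes "C1_on U G"
  shows "continuous_on U (partial_deriv G i j)"
proof -
  obtain G' :: "real^'n \<Rightarrow> (real^'n) \<Rightarrow>\<^sub>L (real^'n)"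
    where G': "\<forall>x\<in>U. (G has_derivative blinfun_apply (G' x)) (at x)" "continuous_on U G'"
    using assms unfolding C1_on_def by blast
  have "continuous_on U (\<lambda>x. blinfun_apply (G' x) (axis j 1) $ i)"
    using G'(2) by (intro continuous_intros)
  then show ?thesis
    by (rule continuous_on_eq) (use G'(1) partial_deriv_eq in metis)
qed

lemma partial_deriv_unique:
  fixes F :: "real^'n \<Rightarrow> real^'n"
  assumes X: "X \<subseteq> closure (interior X)"
    and U: "C1_extension F X U G" and V: "C1_extension F X V H" and x: "x \<in> X"
  shows "partial_deriv G i j x = partial_deriv H i j x"
proof -
  have eq: "partial_deriv G i j y = partial_deriv H i j y" if y: "y \<in> interior X" for y
  proof -
    obtain G' :: "(real^'n) \<Rightarrow>\<^sub>L (real^'n)" where G': "(G has_derivative blinfun_apply G') (at y)"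
      using U y interior_subset unfolding C1_extension_def C1_on_def by blast
    have "(H has_derivative blinfun_apply G') (at y)"
      by (rule has_derivative_transform_within_open[OF G', of "interior X"])
        (use y U V interior_subset[of X] in \<open>auto simp: C1_extension_def subset_iff\<close>)
    with G' show ?thesis
      by (simp add: partial_deriv_eq)
  qed
  have "continuous_on X (\<lambda>y. partial_deriv G i j y - partial_deriv H i j y)"
    using U V continuous_on_partial_deriv continuous_on_subset
    unfolding C1_extension_def by (intro continuous_on_diff) blast+
  then have cont: "continuous (at x within X) (\<lambda>y. partial_deriv G i j y - partial_deriv H i j y)"
    using x by (simp add: continuous_on_eq_continuous_within)
  have "\<exists>s. (\<forall>n. s n \<in> interior X) \<and> s \<longlonglongrightarrow> x"
    using X x by (meson closure_sequential subsetD)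
  then obtain s where s: "\<And>n. s n \<in> interior X" "s \<longlonglongrightarrow> x"
    by blast
  then have "(\<lambda>n. partial_deriv G i j (s n) - partial_deriv H i j (s n))
      \<longlonglongrightarrow> partial_deriv G i j x - partial_deriv H i j x"
    using cont interior_subset
    unfolding continuous_within_sequentially comp_def by blast
  then have "(\<lambda>n. 0) \<longlonglongrightarrow> partial_deriv G i j x - partial_deriv H i j x"
    using eq s(1) by simp
  then show ?thesis
    by (metis LIMSEQ_const_iff eq_iff_diff_eq_0)
qed

lemma partial_on_eq:
  assumes "X \<subseteq> closure (interior X)" "C1_extension F X U G" "x \<in> X"
  shows "partial_on F X i j x = partial_deriv G i j x"
  unfolding partial_on_def
  using assms partial_deriv_unique by (intro the_equality) blast+

section \<open>Solutions and local semiflows\<close>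

text \<open>\<open>J\<close> is a time interval with left end point \<open>0\<close>; the derivative is one-sided at its end points.\<close>

definition solution_in ::
  "(real^'n \<Rightarrow> real^'n) \<Rightarrow> (real^'n) set \<Rightarrow> real^'n \<Rightarrow> real set \<Rightarrow> (real \<Rightarrow> real^'n) \<Rightarrow> bool" where
  "solution_in F X a J u \<longleftrightarrow>
     is_interval J \<and> 0 \<in> J \<and> J \<subseteq> {0..} \<and> u 0 = a \<and>
     (\<forall>t\<in>J. u t \<in> X \<and> (u has_vector_derivative F (u t)) (at t within J))"

definition maximal_solution_in ::
  "(real^'n \<Rightarrow> real^'n) \<Rightarrow> (real^'n) set \<Rightarrow> real^'n \<Rightarrow> real set \<Rightarrow> (real \<Rightarrow> real^'n) \<Rightarrow> bool" where
  "maximal_solution_in F X a J u \<longleftrightarrow>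
     solution_in F X a J u \<and>
     (\<forall>J' v. solution_in F X a J' v \<and> J \<subseteq> J' \<and> (\<forall>t\<in>J. v t = u t) \<longrightarrow> J' = J)"

text \<open>\<open>D t\<close> is the domain of \<open>\<Phi> t\<close>; only times \<open>t \<ge> 0\<close> matter.\<close>

definition local_semiflow ::
  "'a::topological_space set \<Rightarrow> (real \<Rightarrow> 'a set) \<Rightarrow> (real \<Rightarrow> 'a \<Rightarrow> 'a) \<Rightarrow> bool" where
  "local_semiflow X D \<Phi> \<longleftrightarrow>
     (\<forall>t\<ge>0. openin (top_of_set X) (D t) \<and> \<Phi> t ` D t \<subseteq> X \<and> continuous_on (D t) (\<Phi> t)) \<and>
     {0} \<times> X \<subseteq> {(t, x). 0 \<le> t \<and> x \<in> D t} \<and>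
     openin (top_of_set ({0..} \<times> X)) {(t, x). 0 \<le> t \<and> x \<in> D t} \<and>
     continuous_on {(t, x). 0 \<le> t \<and> x \<in> D t} (\<lambda>(t, x). \<Phi> t x) \<and>
     (\<forall>x\<in>X. \<Phi> 0 x = x) \<and>
     (\<forall>s\<ge>0. \<forall>t\<ge>0. \<forall>x. x \<in> D s \<and> \<Phi> s x \<in> D t \<longrightarrow>
        x \<in> D (s + t) \<and> \<Phi> t (\<Phi> s x) = \<Phi> (s + t) x)"

definition ode_system ::
  "(real^'n \<Rightarrow> real^'n) \<Rightarrow> (real^'n) set \<Rightarrow> (real \<Rightarrow> (real^'n) set) \<Rightarrow> (real \<Rightarrow> real^'n \<Rightarrow> real^'n)
     \<Rightarrow> bool" where
  "ode_system F X D \<Phi> \<longleftrightarrow>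
     X \<noteq> {} \<and> convex X \<and> X \<subseteq> closure (interior X) \<and>
     (\<exists>U G. C1_extension F X U G) \<and>
     local_semiflow X D \<Phi> \<and>
     (\<forall>a\<in>X. maximal_solution_in F X a {t. 0 \<le> t \<and> a \<in> D t} (\<lambda>t. \<Phi> t a))"

definition orbit :: "(real \<Rightarrow> 'a set) \<Rightarrow> (real \<Rightarrow> 'a \<Rightarrow> 'a) \<Rightarrow> 'a \<Rightarrow> 'a set" where
  "orbit D \<Phi> x = {\<Phi> t x | t. 0 \<le> t \<and> x \<in> D t}"

definition nowhere_dense_in :: "'a topology \<Rightarrow> 'a set \<Rightarrow> bool" where
  "nowhere_dense_in T S \<longleftrightarrow> S \<subseteq> topspace T \<and> T interior_of (T closure_of S) = {}"

section \<open>The interaction graph\<close>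

text \<open>An edge \<open>(j, i)\<close> means that \<open>x\<^sub>j\<close> influences the \<open>i\<close>-th component of \<open>F\<close>. The label
  \<open>\<theta>\<close> is rendered as \<open>None\<close>.\<close>

definition interaction_edges :: "(real^'n \<Rightarrow> real^'n) \<Rightarrow> (real^'n) set \<Rightarrow> ('n \<times> 'n) set" where
  "interaction_edges F X = {(j, i). j \<noteq> i \<and> \<not> (\<forall>x\<in>X. partial_on F X i j x = 0)}"

definition edge_label :: "(real^'n \<Rightarrow> real^'n) \<Rightarrow> (real^'n) set \<Rightarrow> 'n \<times> 'n \<Rightarrow> int option" where
  "edge_label F X = (\<lambda>(j, i).
     if \<forall>x\<in>X. partial_on F X i j x \<ge> 0 then Some 1
     else if \<forall>x\<in>X. partial_on F X i j x \<le> 0 then Some (- 1)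
     else None)"

text \<open>The loop \<open>(v 0, v 1), \<dots>, (v (\<mu> - 1), v \<mu>)\<close> may repeat vertices and edges.\<close>

definition is_loop :: "('v \<times> 'v) set \<Rightarrow> nat \<Rightarrow> (nat \<Rightarrow> 'v) \<Rightarrow> bool" where
  "is_loop E \<mu> v \<longleftrightarrow> 2 \<le> \<mu> \<and> v \<mu> = v 0 \<and> (\<forall>k<\<mu>. (v k, v (Suc k)) \<in> E)"

definition positive_loop :: "('v \<times> 'v \<Rightarrow> int option) \<Rightarrow> nat \<Rightarrow> (nat \<Rightarrow> 'v) \<Rightarrow> bool" where
  "positive_loop l \<mu> v \<longleftrightarrow>
     (\<forall>k<\<mu>. l (v k, v (Suc k)) \<noteq> None) \<and> (\<Prod>k<\<mu>. the (l (v k, v (Suc k)))) = 1"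

definition coherent :: "(real^'n \<Rightarrow> real^'n) \<Rightarrow> (real^'n) set \<Rightarrow> bool" where
  "coherent F X \<longleftrightarrow>
     (\<forall>\<mu> v. is_loop (interaction_edges F X) \<mu> v \<longrightarrow> positive_loop (edge_label F X) \<mu> v)"

end

theory Submission
  imports Defs
begin

text \<open>
  In a finite directed graph some strongly connected component \<open>C\<close> receives no edge from outside.
  For the interaction graph this means that the components of \<open>F\<close> with index in \<open>C\<close> depend only
  on the coordinates in \<open>C\<close>. Every edge inside \<open>C\<close> lies on a loop, so coherence gives it a sign,
  and since closed walks have sign \<open>+1\<close>, the sign \<open>\<sigma> i\<close> of a walk from a fixed root to \<open>i\<close> does not
  depend on the walk. After the change of coordinates \<open>x\<^sub>i \<mapsto> \<sigma> i * x\<^sub>i\<close> the block \<open>C\<close> is an autonomous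
  cooperative system (\<open>coherent_cooperative_block\<close>), whose solutions preserve the order of
  their initial values (\<open>cooperative_block_monotone\<close>, a form of the Kamke comparison theorem).

  Suppose that an orbit is dense in a nonempty open set \<open>W\<close>. In dimension at least two an arc
  of a differentiable curve is a null set, so deleting an initial piece of the orbit does not destroy
  density (\<open>tail_dense_of_dense\<close>). Hence the orbit returns to every part of \<open>W\<close> at arbitrarily
  late times; in particular it is defined for all times (\<open>global_if_tails_return\<close>). Let \<open>p\<close> be a
  point of the orbit in \<open>W\<close>. After some time \<open>T > 0\<close> the solution \<open>w\<close> through \<open>p\<close> is at a point of \<open>W\<close>
  whose \<open>C\<close>-coordinates are all strictly larger than those of \<open>p\<close>. By continuity the same holds,
  with a uniform margin, at all times \<open>s\<close> near \<open>T\<close>, and monotonicity gives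
  \<open>p < w s \<le> w (2 * s) \<le> w (3 * s) \<le> \<dots>\<close> on \<open>C\<close>. Every large time is a multiple of some such
  \<open>s\<close>, so eventually \<open>w\<close> stays away from \<open>p\<close> (\<open>no_recurrence_after_increase\<close>), although it has to
  return to every neighbourhood of \<open>p\<close>.
\<close>

section \<open>Signs on a source component\<close>

text \<open>The last argument is the product of the labels. A missing label contributes an unspecified
  factor, which is harmless because only edges on loops matter and these are labelled.\<close>

inductive signed_walk :: "('v \<times> 'v) set \<Rightarrow> ('v \<times> 'v \<Rightarrow> int option) \<Rightarrow> 'v \<Rightarrow> 'v \<Rightarrow> int \<Rightarrow> bool"
  for E l where
  refl: "signed_walk E l a a 1"
| step: "signed_walk E l a b s \<Longrightarrow> (b, c) \<in> E \<Longrightarrow> signed_walk E l a c (s * the (l (b, c)))"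

lemma signed_walk_trans:
  assumes "signed_walk E l b c t" "signed_walk E l a b s"
  shows "signed_walk E l a c (s * t)"
  using assms
proof (induction rule: signed_walk.induct)
  case (step b c t d)
  then show ?case
    using signed_walk.step[of E l a c "s * t" d] by (simp add: mult.assoc)
qed simp

lemma signed_walk_of_rtrancl:
  assumes "(a, b) \<in> E\<^sup>*"
  shows "\<exists>s. signed_walk E l a b s"
  using assms by (induction) (auto intro: signed_walk.intros)

text \<open>Translates inductively generated walks into the sequences used to define loops.\<close>

lemma signed_walk_sequence:
  assumes "signed_walk E l a b s"
  shows "\<exists>\<mu> v. v 0 = a \<and> v \<mu> = b \<and> (\<forall>k<\<mu>. (v k, v (Suc k)) \<in> E)
    \<and> s = (\<Prod>k<\<mu>. the (l (v k, v (Suc k))))"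
  using assms
proof (induction rule: signed_walk.induct)
  case (refl a)
  show ?case
    by (rule exI[of _ 0], rule exI[of _ "\<lambda>_. a"]) simp
next
  case (step a b s c)
  then obtain \<mu> v where v: "v 0 = a" "v \<mu> = b" "\<forall>k<\<mu>. (v k, v (Suc k)) \<in> E"
    "s = (\<Prod>k<\<mu>. the (l (v k, v (Suc k))))"
    by blast
  let ?w = "v(Suc \<mu> := c)"
  have "s = (\<Prod>k<\<mu>. the (l (?w k, ?w (Suc k))))"
    unfolding v(4) by (intro prod.cong) auto
  then show ?case
    using v step.hyps(2)
    by (intro exI[of _ "Suc \<mu>"] exI[of _ ?w]) (auto simp: less_Suc_eq)
qed

lemma closed_signed_walk:
  assumes irrefl: "\<And>i. (i, i) \<notin> E"
    and pos: "\<And>\<mu> v. is_loop E \<mu> v \<Longrightarrow> positive_loop l \<mu> v"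
    and walk: "signed_walk E l a a s"
  shows "s = 1"
proof -
  obtain \<mu> v where v: "v 0 = a" "v \<mu> = a" "\<forall>k<\<mu>. (v k, v (Suc k)) \<in> E"
    "s = (\<Prod>k<\<mu>. the (l (v k, v (Suc k))))"
    using signed_walk_sequence[OF walk] by blast
  consider "\<mu> = 0" | "\<mu> = 1" | "2 \<le> \<mu>"
    by linarith
  then show ?thesis
  proof cases
    case 2
    then show ?thesis using v irrefl[of a] by auto
  next
    case 3
    then show ?thesis using pos[of \<mu> v] v by (auto simp: is_loop_def positive_loop_def)
  qed (use v in simp)
qed

text \<open>An edge with a return path is part of a loop, and the edges of positive loops carry a sign.\<close>

lemma edge_on_loop_labelled:
  assumes irrefl: "\<And>i. (i, i) \<notin> E"
    and pos: "\<And>\<mu> v. is_loop E \<mu> v \<Longrightarrow> positive_loop l \<mu> v"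
    and edge: "(j, i) \<in> E" and path: "(i, j) \<in> E\<^sup>*"
  shows "l (j, i) \<noteq> None"
proof -
  obtain s where "signed_walk E l i j s"
    using signed_walk_of_rtrancl[OF path] by blast
  then obtain \<mu> v where v: "v 0 = i" "v \<mu> = j" "\<forall>k<\<mu>. (v k, v (Suc k)) \<in> E"
    using signed_walk_sequence by meson
  let ?w = "v(Suc \<mu> := i)"
  have "\<mu> \<noteq> 0"
    using v edge irrefl by metis
  then have "is_loop E (Suc \<mu>) ?w"
    using v edge by (auto simp: is_loop_def less_Suc_eq)
  then have "l (?w \<mu>, ?w (Suc \<mu>)) \<noteq> None"
    using pos unfolding positive_loop_def by blast
  then show ?thesis
    using v by simp
qed

text \<open>Choose \<open>r\<close> with the fewest ancestors: the ancestors of an ancestor \<open>v\<close> form a subset of those of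
  \<open>r\<close>, hence all of them, so \<open>r\<close> is itself an ancestor of \<open>v\<close>.\<close>

lemma source_component_exists:
  fixes E :: "('v::finite \<times> 'v) set"
  shows "\<exists>r. \<forall>v. (v, r) \<in> E\<^sup>* \<longrightarrow> (r, v) \<in> E\<^sup>*"
proof -
  define anc where "anc r = {v. (v, r) \<in> E\<^sup>*}" for r
  obtain r where r: "\<And>v. card (anc r) \<le> card (anc v)"
    using arg_min_nat_lemma[of "\<lambda>_. True" _ "\<lambda>r. card (anc r)"] by blast
  have "(r, v) \<in> E\<^sup>*" if "(v, r) \<in> E\<^sup>*" for v
  proof -
    have "anc v \<subseteq> anc r"
      using that by (auto simp: anc_def)
    then have "anc v = anc r"
      using r[of v] by (simp add: card_seteq)
    then show ?thesis
      by (auto simp: anc_def)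
  qed
  then show ?thesis
    by blast
qed

text \<open>\<open>C\<close> is the source component of a root \<open>r\<close>, and \<open>\<sigma> i\<close> is the sign of any walk from \<open>r\<close> to \<open>i\<close>. Closing
  such a walk by a fixed return walk of sign \<open>q\<close> shows that its sign is the inverse of \<open>q\<close>. Comparing
  the walk to \<open>i\<close> with the walk to \<open>j\<close> prolonged by an edge \<open>(j, i)\<close> identifies the label of that edge.\<close>

lemma consistent_signs_on_source_component:
  fixes E :: "('v::finite \<times> 'v) set" and l :: "'v \<times> 'v \<Rightarrow> int option"
  assumes irrefl: "\<And>i. (i, i) \<notin> E"
    and pos: "\<And>\<mu> v. is_loop E \<mu> v \<Longrightarrow> positive_loop l \<mu> v"
  obtains C and \<sigma> :: "'v \<Rightarrow> int"
  where "C \<noteq> {}" "\<And>i. i \<in> C \<Longrightarrow> \<sigma> i = 1 \<or> \<sigma> i = - 1"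
    "\<And>i j. i \<in> C \<Longrightarrow> (j, i) \<in> E \<Longrightarrow> j \<in> C \<and> l (j, i) = Some (\<sigma> i * \<sigma> j)"
proof -
  obtain r where r: "\<And>v. (v, r) \<in> E\<^sup>* \<Longrightarrow> (r, v) \<in> E\<^sup>*"
    using source_component_exists by blast
  define C where "C = {v. (v, r) \<in> E\<^sup>*}"
  define \<sigma> where "\<sigma> i = (SOME s. signed_walk E l r i s)" for i
  have \<sigma>: "signed_walk E l r i (\<sigma> i)" if "i \<in> C" for i
    unfolding \<sigma>_def
    by (rule someI_ex, rule signed_walk_of_rtrancl, rule r) (use that in \<open>simp add: C_def\<close>)
  have unit: "\<sigma> i = 1 \<or> \<sigma> i = - 1" if "i \<in> C" for i
  proof -
    obtain q where "signed_walk E l i r q"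
      using \<open>i \<in> C\<close> signed_walk_of_rtrancl unfolding C_def by fast
    then have "\<sigma> i * q = 1"
      using closed_signed_walk[OF irrefl pos] signed_walk_trans \<sigma>[OF that] by meson
    then show ?thesis
      by (simp add: zmult_eq_1_iff) blast
  qed
  have "j \<in> C \<and> l (j, i) = Some (\<sigma> i * \<sigma> j)" if i: "i \<in> C" and ji: "(j, i) \<in> E" for i j
  proof -
    have j: "j \<in> C"
      using i ji by (auto simp: C_def intro: converse_rtrancl_into_rtrancl)
    have "(i, j) \<in> E\<^sup>*"
      using i r[of j] j unfolding C_def by (auto intro: rtrancl_trans)
    then obtain e where e: "l (j, i) = Some e"
      using edge_on_loop_labelled[OF irrefl pos ji] by blast
    obtain q where q: "signed_walk E l i r q"
      using i signed_walk_of_rtrancl unfolding C_def by fast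
    have "signed_walk E l r i (\<sigma> j * e)"
      using signed_walk.step[OF \<sigma>[OF j] ji] e by simp
    then have "(\<sigma> j * e) * q = 1" "\<sigma> i * q = 1"
      using closed_signed_walk[OF irrefl pos] signed_walk_trans q \<sigma>[OF i] by meson+
    then have "\<sigma> j * e = \<sigma> i"
      by (metis mult_cancel_right mult_zero_right zero_neq_one)
    then have "e = \<sigma> i * \<sigma> j"
      using unit[OF j] by auto
    then show ?thesis
      using j e by simp
  qed
  moreover have "C \<noteq> {}"
    by (auto simp: C_def)
  ultimately show ?thesis
    using that unit by blast
qed

text \<open>The block \<open>C\<close> is closed under predecessors in the interaction graph, so its components of \<open>F\<close> are
  independent of the coordinates outside \<open>C\<close>; inside \<open>C\<close> the edge labels are products of the signs
  of their end points, which is cooperativity in the order of the orthant given by \<open>\<sigma>\<close>.\<close>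

lemma coherent_cooperative_block:
  fixes F :: "real^'n \<Rightarrow> real^'n"
  assumes "coherent F X"
  obtains C and \<sigma> :: "'n \<Rightarrow> real"
  where "C \<noteq> {}" "\<And>i. i \<in> C \<Longrightarrow> \<bar>\<sigma> i\<bar> = 1"
    "\<And>i j x. \<lbrakk>i \<in> C; j \<notin> C; x \<in> X\<rbrakk> \<Longrightarrow> partial_on F X i j x = 0"
    "\<And>i j x. \<lbrakk>i \<in> C; j \<in> C; j \<noteq> i; x \<in> X\<rbrakk> \<Longrightarrow> 0 \<le> \<sigma> i * \<sigma> j * partial_on F X i j x"
proof -
  let ?E = "interaction_edges F X" and ?l = "edge_label F X"
  obtain C and \<sigma> :: "'n \<Rightarrow> int" where C: "C \<noteq> {}" "\<And>i. i \<in> C \<Longrightarrow> \<sigma> i = 1 \<or> \<sigma> i = - 1"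
    "\<And>i j. i \<in> C \<Longrightarrow> (j, i) \<in> ?E \<Longrightarrow> j \<in> C \<and> ?l (j, i) = Some (\<sigma> i * \<sigma> j)"
    by (rule consistent_signs_on_source_component[of ?E ?l])
      (use assms in \<open>auto simp: coherent_def interaction_edges_def\<close>)
  have "partial_on F X i j x = 0" if "i \<in> C" "j \<notin> C" "x \<in> X" for i j x
    using C(3)[OF that(1), of j] that by (auto simp: interaction_edges_def)
  moreover have "0 \<le> of_int (\<sigma> i) * of_int (\<sigma> j) * partial_on F X i j x"
    if "i \<in> C" "j \<in> C" "j \<noteq> i" "x \<in> X" for i j x
  proof (cases "(j, i) \<in> ?E")
    case True
    then have "?l (j, i) = Some (\<sigma> i * \<sigma> j)"
      using C(3) that(1) by blast
    moreover have "(\<sigma> i * \<sigma> j = 1 \<longrightarrow> 0 \<le> partial_on F X i j x) \<and>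
        (\<sigma> i * \<sigma> j = - 1 \<longrightarrow> partial_on F X i j x \<le> 0)"
      using calculation that(4) by (auto simp: edge_label_def split: if_splits)
    ultimately show ?thesis
      using C(2)[OF that(1)] C(2)[OF that(2)] by auto
  next
    case False
    then show ?thesis
      using that by (auto simp: interaction_edges_def)
  qed
  ultimately show ?thesis
    using that[of C "\<lambda>i. of_int (\<sigma> i)"] C(1,2) by fastforce
qed

section \<open>Comparison of solutions\<close>

text \<open>At the first time \<open>\<tau>\<close> at which some component vanishes all components are still nonnegative. The
  vanishing one was positive before \<open>\<tau>\<close>, which contradicts its positive derivative at \<open>\<tau>\<close>.\<close>

lemma positive_if_derivative_positive_at_first_zero:
  fixes v v' :: "'i \<Rightarrow> real \<Rightarrow> real"
  assumes fin: "finite C"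
    and deriv: "\<And>i t. \<lbrakk>i \<in> C; t \<in> {0..T}\<rbrakk> \<Longrightarrow> (v i has_real_derivative v' i t) (at t within {0..T})"
    and init: "\<And>i. i \<in> C \<Longrightarrow> 0 < v i 0"
    and zero: "\<And>i t. \<lbrakk>i \<in> C; t \<in> {0..T}; v i t = 0; \<And>j. j \<in> C \<Longrightarrow> 0 \<le> v j t\<rbrakk> \<Longrightarrow> 0 < v' i t"
    and "i \<in> C" "t \<in> {0..T}"
  shows "0 < v i t"
proof (rule ccontr)
  assume "\<not> 0 < v i t"
  define S where "S = (\<Union>i\<in>C. {0..T} \<inter> v i -` {..0})"
  have cont: "continuous_on {0..T} (v i)" if "i \<in> C" for i
    using DERIV_continuous_on deriv that by blast
  have closed: "closed S"
    unfolding S_def using fin continuous_closed_preimage[OF cont closed_atLeastAtMost closed_atMost]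
    by (intro closed_UN) auto
  have "t \<in> S"
    using \<open>\<not> 0 < v i t\<close> \<open>i \<in> C\<close> \<open>t \<in> {0..T}\<close>
    by (auto simp: S_def not_less intro: bexI[of _ i])
  have bdd: "bdd_below S"
    by (auto simp: S_def bdd_below_def)
  define \<tau> where "\<tau> = Inf S"
  have "\<tau> \<in> S"
    unfolding \<tau>_def using closed_contains_Inf[OF _ bdd closed] \<open>t \<in> S\<close> by blast
  then obtain k where k: "k \<in> C" "v k \<tau> \<le> 0" and \<tau>: "\<tau> \<in> {0..T}"
    by (auto simp: S_def)
  have before: "0 < v j s" if "j \<in> C" "0 \<le> s" "s < \<tau>" for j s
  proof (rule ccontr)
    assume "\<not> 0 < v j s"
    then have "s \<in> S"
      using that \<tau> by (auto simp: S_def not_less intro: bexI[of _ j])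
    then have "\<tau> \<le> s"
      unfolding \<tau>_def using bdd by (rule cInf_lower)
    with that show False by simp
  qed
  have "\<tau> \<noteq> 0"
    using init[OF k(1)] k(2) by auto
  then have "0 < \<tau>"
    using \<tau> by auto
  have nonneg: "0 \<le> v j \<tau>" if "j \<in> C" for j
  proof (rule ccontr)
    assume neg: "\<not> 0 \<le> v j \<tau>"
    have "\<exists>s\<ge>0. s \<le> \<tau> \<and> v j s = 0"
      using neg init[OF that] \<open>0 < \<tau>\<close> \<tau> continuous_on_subset[OF cont[OF that], of "{0..\<tau>}"]
      by (intro IVT2') auto
    then obtain s where "0 \<le> s" "s \<le> \<tau>" "v j s = 0"
      by blast
    then show False
      using before[OF that, of s] neg by (cases "s = \<tau>") auto
  qed
  then have "v k \<tau> = 0"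
    using k by force
  then have "0 < v' k \<tau>"
    using zero k \<tau> nonneg by blast
  then obtain d where d: "0 < d" "\<And>h. \<lbrakk>0 < h; \<tau> - h \<in> {0..T}; h < d\<rbrakk> \<Longrightarrow> v k (\<tau> - h) < v k \<tau>"
    using has_real_derivative_pos_inc_left[OF deriv[OF k(1) \<tau>]] by blast
  define h where "h = min d \<tau> / 2"
  have h: "0 < h" "h < d" "h < \<tau>"
    using d(1) \<open>0 < \<tau>\<close> by (auto simp: h_def)
  then have "v k (\<tau> - h) < 0"
    using d(2)[of h] \<tau> \<open>v k \<tau> = 0\<close> by auto
  then show False
    using before[OF k(1), of "\<tau> - h"] h by auto
qed

text \<open>For a single component of \<open>G\<close> the mean value theorem along the segment holds as an equality.
  The intermediate point depends on the component.\<close>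

lemma component_increment_mean_value:
  fixes G :: "real^'n \<Rightarrow> real^'n"
  assumes deriv: "\<And>z. z \<in> closed_segment a b \<Longrightarrow> G differentiable (at z)"
  obtains z where "z \<in> closed_segment a b"
    "G b $ i - G a $ i = (\<Sum>j\<in>UNIV. partial_deriv G i j z * (b $ j - a $ j))"
proof -
  define p where "p s = a + s *\<^sub>R (b - a)" for s :: real
  have p: "p s \<in> closed_segment a b" if "0 \<le> s" "s \<le> 1" for s
    using that by (auto simp: p_def closed_segment_def algebra_simps intro!: exI[of _ s])
  define G' where "G' z = frechet_derivative G (at z)" for z
  have G': "(G has_derivative G' z) (at z)" if "z \<in> closed_segment a b" for z
    using deriv[OF that] unfolding G'_def by (simp add: frechet_derivative_works)
  have "((\<lambda>s. G (p s) $ i) has_derivative (\<lambda>h. G' (p s) (h *\<^sub>R (b - a)) $ i)) (at s within {0..1})"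
    if "0 \<le> s" "s \<le> 1" for s
  proof -
    have "(p has_derivative (\<lambda>h. h *\<^sub>R (b - a))) (at s within {0..1})"
      unfolding p_def by (auto intro!: derivative_eq_intros)
    from has_derivative_compose[OF this G'[OF p[OF that]]]
    show ?thesis
      by (rule bounded_linear.has_derivative[OF bounded_linear_vec_nth])
  qed
  then obtain s where s: "s \<in> {0<..<1}"
    "G (p 1) $ i - G (p 0) $ i = G' (p s) ((1 - 0) *\<^sub>R (b - a)) $ i"
    using mvt_simple[of 0 1 "\<lambda>s. G (p s) $ i" "\<lambda>s h. G' (p s) (h *\<^sub>R (b - a)) $ i"] by auto
  have z: "p s \<in> closed_segment a b"
    using p s by auto
  have lin: "linear (G' (p s))"
    using has_derivative_linear[OF G'[OF z]] .
  have "G' (p s) (b - a) = G' (p s) (\<Sum>j\<in>UNIV. (b - a) $ j *\<^sub>R axis j 1)"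
    by (simp only: basis_expansion scalar_mult_eq_scaleR[symmetric])
  also have "\<dots> = (\<Sum>j\<in>UNIV. (b - a) $ j *\<^sub>R G' (p s) (axis j 1))"
    using lin by (simp add: linear_sum linear_scale)
  finally have "G' (p s) (b - a) $ i = (\<Sum>j\<in>UNIV. partial_deriv G i j (p s) * (b $ j - a $ j))"
    by (simp add: partial_deriv_eq[OF G'[OF z]] mult.commute)
  then show ?thesis
    using that[OF z] s(2) by (simp add: p_def)
qed

text \<open>The Kamke comparison theorem for a block \<open>C\<close> that is cooperative up to signs. Let \<open>z\<close> be the
  signed difference of the two solutions. By the mean value theorem its derivative is
  a linear expression in \<open>z\<close> with nonnegative coefficients off the diagonal. To avoid the boundary
  case \<open>z = 0\<close>, it is perturbed to \<open>z + \<epsilon> * exp (M * t)\<close>. When a component of this vanishes while the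
  others are nonnegative, all \<open>z\<^sub>j\<close> are at least \<open>- \<epsilon> * exp (M * t)\<close>, so the derivative of \<open>z\<^sub>i\<close> is
  larger than \<open>- M * \<epsilon> * exp (M * t)\<close> if \<open>M\<close> exceeds the row sums of the Jacobian, and the derivative
  of the perturbed component is positive. Convexity of \<open>X\<close> keeps the segments between
  the solutions in the region where the sign conditions hold.\<close>

lemma cooperative_block_monotone:
  fixes G :: "real^'n \<Rightarrow> real^'n" and \<sigma> :: "'n \<Rightarrow> real"
  assumes X: "convex X" "X \<subseteq> U" and U: "open U" and G: "C1_on U G"
    and unit: "\<And>i. i \<in> C \<Longrightarrow> \<bar>\<sigma> i\<bar> = 1"
    and off: "\<And>i j z. \<lbrakk>i \<in> C; j \<notin> C; z \<in> X\<rbrakk> \<Longrightarrow> partial_deriv G i j z = 0"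
    and coop: "\<And>i j z. \<lbrakk>i \<in> C; j \<in> C; j \<noteq> i; z \<in> X\<rbrakk> \<Longrightarrow> 0 \<le> \<sigma> i * \<sigma> j * partial_deriv G i j z"
    and x: "\<And>t. t \<in> {0..T} \<Longrightarrow> x t \<in> X \<and> (x has_vector_derivative G (x t)) (at t within {0..T})"
    and y: "\<And>t. t \<in> {0..T} \<Longrightarrow> y t \<in> X \<and> (y has_vector_derivative G (y t)) (at t within {0..T})"
    and init: "\<And>i. i \<in> C \<Longrightarrow> \<sigma> i * x 0 $ i \<le> \<sigma> i * y 0 $ i"
    and i: "i \<in> C" and t: "t \<in> {0..T}"
  shows "\<sigma> i * x t $ i \<le> \<sigma> i * y t $ i"
proof -
  define K where "K = (\<lambda>(s, t). (1 - s) *\<^sub>R x t + s *\<^sub>R y t) ` ({0..1} \<times> {0..T})"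
  have cont: "continuous_on {0..T} x" "continuous_on {0..T} y"
    by (rule continuous_on_vector_derivative, rule x[THEN conjunct2] y[THEN conjunct2], assumption)+
  have K: "closed_segment (x t) (y t) \<subseteq> K" if "t \<in> {0..T}" for t
    using that by (force simp: K_def closed_segment_def)
  have "compact K"
    unfolding K_def case_prod_unfold
    by (intro compact_continuous_image compact_Times continuous_intros
        continuous_on_compose2[OF cont(1)] continuous_on_compose2[OF cont(2)]) auto
  have "K \<subseteq> X"
    using x y X(1) by (auto simp: K_def convex_alt)
  have "\<exists>B. \<forall>z\<in>K. \<bar>partial_deriv G i j z\<bar> \<le> B" for i j
  proof -
    have "continuous_on K (partial_deriv G i j)"
      using continuous_on_partial_deriv[OF G] continuous_on_subset \<open>K \<subseteq> X\<close> X(2) by blast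
    then have "bounded (partial_deriv G i j ` K)"
      using \<open>compact K\<close> compact_continuous_image compact_imp_bounded by blast
    then show ?thesis
      by (auto simp: bounded_iff)
  qed
  then obtain B where B: "\<And>i j z. z \<in> K \<Longrightarrow> \<bar>partial_deriv G i j z\<bar> \<le> B i j"
    by metis
  define M where "M = (\<Sum>i\<in>UNIV. \<Sum>j\<in>UNIV. \<bar>B i j\<bar>) + 1"
  have row: "(\<Sum>j\<in>UNIV. \<bar>partial_deriv G i j z\<bar>) < M" if "z \<in> K" for i z
  proof -
    have "(\<Sum>j\<in>UNIV. \<bar>partial_deriv G i j z\<bar>) \<le> (\<Sum>j\<in>UNIV. \<bar>B i j\<bar>)"
      by (intro sum_mono order.trans[OF B[OF that]]) auto
    also have "\<dots> \<le> (\<Sum>i\<in>UNIV. \<Sum>j\<in>UNIV. \<bar>B i j\<bar>)"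
      by (rule member_le_sum[of i UNIV "\<lambda>i. \<Sum>j\<in>UNIV. \<bar>B i j\<bar>"]) (auto intro: sum_nonneg)
    finally show ?thesis
      by (simp add: M_def)
  qed
  have diff: "G differentiable (at z)" if "z \<in> X" for z
    using G that X(2) unfolding C1_on_def differentiable_def by blast
  define z where "z i t = \<sigma> i * (y t $ i - x t $ i)" for i t
  have main: "0 < z i t + \<epsilon> * exp (M * t)" if "0 < \<epsilon>" for \<epsilon>
  proof (rule positive_if_derivative_positive_at_first_zero[where C = C and T = T
        and v = "\<lambda>i t. z i t + \<epsilon> * exp (M * t)"
        and v' = "\<lambda>i t. \<sigma> i * (G (y t) $ i - G (x t) $ i) + \<epsilon> * (M * exp (M * t))"])
    fix k s assume k: "k \<in> C" and s: "s \<in> {0..T}"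
    have "((\<lambda>t. x t $ k) has_real_derivative G (x s) $ k) (at s within {0..T})"
      "((\<lambda>t. y t $ k) has_real_derivative G (y s) $ k) (at s within {0..T})"
      using x[OF s] y[OF s]
        bounded_linear.has_vector_derivative[OF bounded_linear_vec_nth[of k]]
      by (auto simp: has_real_derivative_iff_has_vector_derivative)
    then show "((\<lambda>t. z k t + \<epsilon> * exp (M * t)) has_real_derivative
        \<sigma> k * (G (y s) $ k - G (x s) $ k) + \<epsilon> * (M * exp (M * s))) (at s within {0..T})"
      unfolding z_def by (auto intro!: derivative_eq_intros)
    assume zero: "z k s + \<epsilon> * exp (M * s) = 0"
      and nonneg: "\<And>j. j \<in> C \<Longrightarrow> 0 \<le> z j s + \<epsilon> * exp (M * s)"
    define e where "e = \<epsilon> * exp (M * s)"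
    have "0 < e"
      using that by (simp add: e_def)
    have seg: "closed_segment (x s) (y s) \<subseteq> X"
      using K[OF s] \<open>K \<subseteq> X\<close> by blast
    then obtain \<xi> where \<xi>: "\<xi> \<in> closed_segment (x s) (y s)"
      "G (y s) $ k - G (x s) $ k = (\<Sum>j\<in>UNIV. partial_deriv G k j \<xi> * (y s $ j - x s $ j))"
      using component_increment_mean_value[of "x s" "y s" G k] diff by blast
    have "\<xi> \<in> K" "\<xi> \<in> X"
      using \<xi> K[OF s] seg by blast+
    have "- (\<bar>partial_deriv G k j \<xi>\<bar> * e) \<le> \<sigma> k * (partial_deriv G k j \<xi> * (y s $ j - x s $ j))"
      (is "?l j \<le> ?r j") for j
    proof (cases "j \<in> C")
      case False
      then show ?thesis
        using off[OF k False \<open>\<xi> \<in> X\<close>] by simp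
    next
      case True
      have "\<sigma> j * \<sigma> j = 1"
        using unit[OF True] by (metis abs_mult_self_eq mult_1)
      then have r: "?r j = (\<sigma> k * \<sigma> j * partial_deriv G k j \<xi>) * z j s"
        unfolding z_def by (simp add: mult_ac)
      have abs: "\<bar>\<sigma> k * \<sigma> j * partial_deriv G k j \<xi>\<bar> = \<bar>partial_deriv G k j \<xi>\<bar>"
        using unit[OF True] unit[OF k] by (simp add: abs_mult)
      show ?thesis
      proof (cases "j = k")
        case True
        then have "z j s = - e"
          using zero by (simp add: e_def)
        then show ?thesis
          unfolding r using \<open>0 < e\<close> abs abs_ge_self[of "\<sigma> k * \<sigma> j * partial_deriv G k j \<xi>"]
          by (simp add: mult_right_mono)
      next
        case False
        have "0 \<le> \<sigma> k * \<sigma> j * partial_deriv G k j \<xi>"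
          using coop[OF k \<open>j \<in> C\<close> False \<open>\<xi> \<in> X\<close>] .
        moreover have "- e \<le> z j s"
          using nonneg[OF \<open>j \<in> C\<close>] by (simp add: e_def)
        ultimately have "(\<sigma> k * \<sigma> j * partial_deriv G k j \<xi>) * (- e) \<le> ?r j"
          unfolding r by (intro mult_left_mono) auto
        then show ?thesis
          using abs \<open>0 \<le> \<sigma> k * \<sigma> j * partial_deriv G k j \<xi>\<close> by simp
      qed
    qed
    then have "(\<Sum>j\<in>UNIV. - (\<bar>partial_deriv G k j \<xi>\<bar> * e)) \<le> \<sigma> k * (G (y s) $ k - G (x s) $ k)"
      unfolding \<xi>(2) sum_distrib_left by (intro sum_mono)
    then have "- ((\<Sum>j\<in>UNIV. \<bar>partial_deriv G k j \<xi>\<bar>) * e) \<le> \<sigma> k * (G (y s) $ k - G (x s) $ k)"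
      by (simp add: sum_negf sum_distrib_right)
    moreover have "(\<Sum>j\<in>UNIV. \<bar>partial_deriv G k j \<xi>\<bar>) * e < M * e"
      using row[OF \<open>\<xi> \<in> K\<close>] \<open>0 < e\<close> by simp
    ultimately have "0 < \<sigma> k * (G (y s) $ k - G (x s) $ k) + M * e"
      by linarith
    then show "0 < \<sigma> k * (G (y s) $ k - G (x s) $ k) + \<epsilon> * (M * exp (M * s))"
      by (simp add: e_def mult.left_commute)
  next
    fix k assume "k \<in> C"
    then show "0 < z k 0 + \<epsilon> * exp (M * 0)"
      using init[of k] that by (simp add: z_def algebra_simps)
  qed (use i t in auto)
  have "0 \<le> z i t"
  proof (rule ccontr)
    assume "\<not> 0 \<le> z i t"
    then have "0 < - z i t * exp (- (M * t))"
      by (simp add: mult_less_0_iff)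
    \<comment> \<open>for this \<open>\<epsilon>\<close> the perturbation cancels \<open>z i t\<close> exactly\<close>
    from main[OF this] have "0 < z i t - z i t * (exp (- (M * t)) * exp (M * t))"
      by simp
    then show False
      by (simp add: exp_minus)
  qed
  then show ?thesis
    by (simp add: z_def algebra_simps)
qed

section \<open>Density of the tails of an orbit\<close>

text \<open>The part of \<open>W\<close> missed by the closure of the tail is open and contained in the initial arc, which
  is a null set in dimension at least two.\<close>

lemma tail_dense_of_dense:
  fixes u :: "real \<Rightarrow> 'a::euclidean_space"
  assumes dim: "2 \<le> DIM('a)" and "open W" and dense: "W \<subseteq> closure (u ` J)"
    and J: "J \<subseteq> {0..}" "{0..\<tau>} \<subseteq> J" and u: "u differentiable_on J"
  shows "W \<subseteq> closure (u ` (J \<inter> {\<tau>..}))"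
proof -
  let ?K = "u ` {0..\<tau>}"
  have "u differentiable_on {0..\<tau>}"
    using u J(2) differentiable_on_subset by blast
  then have "negligible ?K" and "compact ?K"
    using dim by (auto intro!: negligible_differentiable_image_lowdim
        compact_continuous_image differentiable_imp_continuous_on)
  have "u ` J \<subseteq> ?K \<union> u ` (J \<inter> {\<tau>..})"
    using J by force
  then have "closure (u ` J) \<subseteq> ?K \<union> closure (u ` (J \<inter> {\<tau>..}))"
    using \<open>compact ?K\<close> compact_imp_closed closure_Un closure_closed closure_mono by metis
  then have "W - closure (u ` (J \<inter> {\<tau>..})) \<subseteq> ?K"
    using dense by blast
  then have "negligible (W - closure (u ` (J \<inter> {\<tau>..})))"
    using \<open>negligible ?K\<close> negligible_subset by blast
  moreover have "open (W - closure (u ` (J \<inter> {\<tau>..})))"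
    using \<open>open W\<close> by (intro open_Diff) auto
  ultimately show ?thesis
    using open_not_negligible by blast
qed

lemma dense_tail_meets:
  assumes "W \<subseteq> closure (u ` A)" "open V" "p \<in> V" "p \<in> W"
  obtains t where "t \<in> A" "u t \<in> V"
  using assms open_Int_closure_eq_empty[of V "u ` A"] by blast

text \<open>The domain of the semiflow is a neighbourhood of \<open>(0, p)\<close>, so solutions starting near \<open>p\<close> share
  a lower bound for their life span.\<close>

lemma local_semiflow_uniform_time:
  fixes D :: "real \<Rightarrow> 'a::metric_space set"
  assumes "local_semiflow X D \<Phi>" "p \<in> X"
  obtains \<epsilon> where "0 < \<epsilon>" "\<And>q. \<lbrakk>q \<in> X; dist q p < \<epsilon>\<rbrakk> \<Longrightarrow> q \<in> D \<epsilon>"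
proof -
  let ?A = "{(t, x). 0 \<le> t \<and> x \<in> D t}"
  have "openin (top_of_set ({0..} \<times> X)) ?A" "(0, p) \<in> ?A"
    using assms unfolding local_semiflow_def by blast+
  then obtain e where e: "0 < e"
    "\<And>z. \<lbrakk>z \<in> {0..} \<times> X; dist z (0, p) < e\<rbrakk> \<Longrightarrow> z \<in> ?A"
    unfolding openin_euclidean_subtopology_iff by blast
  have "q \<in> D (e / 2)" if "q \<in> X" "dist q p < e / 2" for q
  proof -
    have "dist (e / 2, q) (0, p) \<le> dist (e / 2) 0 + dist q p"
      unfolding dist_prod_def fst_conv snd_conv by (rule sqrt_sum_squares_le_sum) auto
    also have "\<dots> < e"
      using that(2) e(1) by simp
    finally show ?thesis
      using e(2)[of "(e / 2, q)"] that(1) e(1) by auto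
  qed
  then show ?thesis
    using that[of "e / 2"] e(1) by auto
qed

text \<open>Each return close to \<open>p\<close> prolongs the solution by the uniform time \<open>\<epsilon>\<close>, so it cannot end.\<close>

lemma global_if_tails_return:
  fixes D :: "real \<Rightarrow> 'a::metric_space set"
  assumes flow: "local_semiflow X D \<Phi>" and x: "x \<in> X" and "p \<in> X"
    and J: "J = {t. 0 \<le> t \<and> x \<in> D t}" "is_interval J"
    and return: "\<And>\<tau> V. \<lbrakk>\<tau> \<in> J; open V; p \<in> V\<rbrakk> \<Longrightarrow> \<exists>t\<in>J. \<tau> \<le> t \<and> \<Phi> t x \<in> V"
  shows "J = {0..}"
proof -
  obtain \<epsilon> where \<epsilon>: "0 < \<epsilon>" "\<And>q. \<lbrakk>q \<in> X; dist q p < \<epsilon>\<rbrakk> \<Longrightarrow> q \<in> D \<epsilon>"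
    using local_semiflow_uniform_time[OF flow \<open>p \<in> X\<close>] by blast
  have later: "\<exists>t\<in>J. \<tau> + \<epsilon> \<le> t" if \<tau>: "\<tau> \<in> J" for \<tau>
  proof -
    obtain t where t: "t \<in> J" "\<tau> \<le> t" "\<Phi> t x \<in> ball p \<epsilon>"
      using return[OF \<tau>, of "ball p \<epsilon>"] \<epsilon>(1) by auto
    have "x \<in> D t" "0 \<le> t"
      using t(1) J(1) by auto
    then have "\<Phi> t x \<in> X"
      using flow unfolding local_semiflow_def by blast
    then have "\<Phi> t x \<in> D \<epsilon>"
      using \<epsilon>(2) t(3) by (simp add: dist_commute)
    then have "x \<in> D (t + \<epsilon>)"
      using flow \<open>x \<in> D t\<close> \<open>0 \<le> t\<close> \<epsilon>(1) unfolding local_semiflow_def by (meson less_imp_le)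
    then show ?thesis
      using J(1) \<open>0 \<le> t\<close> \<epsilon>(1) t(2) by (intro bexI[of _ "t + \<epsilon>"]) auto
  qed
  have "0 \<in> J"
    using flow x J(1) unfolding local_semiflow_def by blast
  have mult: "\<exists>t\<in>J. real m * \<epsilon> \<le> t" for m
  proof (induction m)
    case 0
    show ?case using \<open>0 \<in> J\<close> by auto
  next
    case (Suc m)
    then obtain t where "t \<in> J" "real m * \<epsilon> \<le> t" by blast
    moreover from this obtain t' where "t' \<in> J" "t + \<epsilon> \<le> t'" using later by blast
    ultimately show ?case
      by (intro bexI[of _ t']) (auto simp: algebra_simps)
  qed
  have "s \<in> J" if "0 \<le> s" for s
  proof -
    obtain m where "s < real m * \<epsilon>"
      using reals_Archimedean3[OF \<epsilon>(1)] by blast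
    then obtain t where "t \<in> J" "s \<le> t"
      using mult[of m] by force
    then show ?thesis
      using J(2) \<open>0 \<in> J\<close> that unfolding is_interval_1 by blast
  qed
  then show ?thesis
    using J(1) by auto
qed

section \<open>Monotonicity excludes recurrence\<close>

text \<open>On a time interval \<open>[T, T + \<delta>)\<close> the curve lies above \<open>w 0\<close> on \<open>C\<close> with a margin \<open>\<eta>\<close>. By monotonicity
  the margin persists at all multiples of times in this interval, and these multiples cover
  all sufficiently large times.\<close>

lemma no_recurrence_after_increase:
  fixes w :: "real \<Rightarrow> real^'n" and \<sigma> :: "'n \<Rightarrow> real"
  assumes cont: "continuous_on {0..} w" and T: "0 < T"
    and unit: "\<And>i. i \<in> C \<Longrightarrow> \<bar>\<sigma> i\<bar> = 1" and "C \<noteq> {}"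
    and mono: "\<And>s r i. \<lbrakk>0 \<le> s; 0 \<le> r; \<And>j. j \<in> C \<Longrightarrow> \<sigma> j * w 0 $ j \<le> \<sigma> j * w s $ j; i \<in> C\<rbrakk>
      \<Longrightarrow> \<sigma> i * w r $ i \<le> \<sigma> i * w (s + r) $ i"
    and increase: "\<And>i. i \<in> C \<Longrightarrow> \<sigma> i * w 0 $ i < \<sigma> i * w T $ i"
  shows "\<exists>\<eta>>0. \<exists>t0. \<forall>t\<ge>t0. \<eta> \<le> dist (w t) (w 0)"
proof -
  define \<eta> where "\<eta> = Min ((\<lambda>i. \<sigma> i * w T $ i - \<sigma> i * w 0 $ i) ` C) / 2"
  have "0 < \<eta>"
    unfolding \<eta>_def using \<open>C \<noteq> {}\<close> increase by (simp add: Min_gr_iff)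
  have margin: "2 * \<eta> \<le> \<sigma> i * w T $ i - \<sigma> i * w 0 $ i" if "i \<in> C" for i
    unfolding \<eta>_def using that by (simp add: Min_le_iff)
  have near: "\<bar>\<sigma> i * a $ i - \<sigma> i * b $ i\<bar> \<le> dist a b" if "i \<in> C" for i and a b :: "real^'n"
  proof -
    have "\<bar>\<sigma> i * a $ i - \<sigma> i * b $ i\<bar> = \<bar>(a - b) $ i\<bar>"
      using unit[OF that] by (simp add: abs_mult flip: right_diff_distrib)
    then show ?thesis
      using component_le_norm_cart[of "a - b" i] by (simp add: dist_norm)
  qed
  obtain \<delta> where \<delta>: "0 < \<delta>" "\<And>s. \<lbrakk>0 \<le> s; dist s T < \<delta>\<rbrakk> \<Longrightarrow> dist (w s) (w T) < \<eta>"
    using cont T \<open>0 < \<eta>\<close> unfolding continuous_on_iff by (metis atLeast_iff less_imp_le)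
  have above: "\<sigma> i * w 0 $ i + \<eta> \<le> \<sigma> i * w s $ i" if "i \<in> C" "T \<le> s" "s < T + \<delta>" for i s
    using near[OF that(1), of "w s" "w T"] \<delta>(2)[of s] margin[OF that(1)] that T
    by (auto simp: dist_real_def)
  have multiples: "\<sigma> i * w s $ i \<le> \<sigma> i * w (real (Suc m) * s) $ i"
    if "i \<in> C" "T \<le> s" "s < T + \<delta>" for i s m
  proof (induction m)
    case (Suc m)
    have "\<sigma> i * w (real (Suc m) * s) $ i \<le> \<sigma> i * w (s + real (Suc m) * s) $ i"
    proof (rule mono)
      fix j assume "j \<in> C"
      then show "\<sigma> j * w 0 $ j \<le> \<sigma> j * w s $ j"
        using above[of j s] that \<open>0 < \<eta>\<close> by auto
    qed (use that T in auto)
    also have "s + real (Suc m) * s = real (Suc (Suc m)) * s"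
      by (simp add: algebra_simps)
    finally show ?case
      using Suc by simp
  qed simp
  obtain i where "i \<in> C"
    using \<open>C \<noteq> {}\<close> by blast
  have "\<eta> \<le> dist (w t) (w 0)" if t: "T * (T / \<delta> + 2) \<le> t" for t
  proof -
    \<comment> \<open>\<open>t\<close> is split into \<open>m\<close> steps of length \<open>s\<close>; the excess of \<open>s\<close> over \<open>T\<close> is below \<open>T / m\<close>\<close>
    define m where "m = nat \<lfloor>t / T\<rfloor>"
    have tT: "T / \<delta> + 2 \<le> t / T"
      using t T by (simp add: field_simps)
    moreover have "0 \<le> T / \<delta>"
      using T \<delta>(1) by simp
    ultimately have m: "real m \<le> t / T" "t / T < real m + 1"
      unfolding m_def by linarith+
    then have m1: "T / \<delta> < real m" "1 \<le> m"
      using tT \<open>0 \<le> T / \<delta>\<close> by linarith+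
    define s where "s = t / real m"
    have "T \<le> s"
      using m m1 T by (simp add: s_def field_simps)
    moreover have "s < T + \<delta>"
    proof -
      have "t < real m * T + T"
        using m(2) T by (simp add: field_simps)
      moreover have "T < real m * \<delta>"
        using m1(1) \<delta>(1) by (simp add: field_simps)
      ultimately have "t < real m * (T + \<delta>)"
        unfolding distrib_left by linarith
      then show ?thesis
        using m1(2) by (simp add: s_def field_simps)
    qed
    ultimately have "\<sigma> i * w 0 $ i + \<eta> \<le> \<sigma> i * w (real (Suc (m - 1)) * s) $ i"
      using multiples[OF \<open>i \<in> C\<close>, of s "m - 1"] above[OF \<open>i \<in> C\<close>, of s] by linarith
    moreover have "real (Suc (m - 1)) * s = t"
      using m1(2) by (simp add: s_def)
    ultimately show ?thesis
      using near[OF \<open>i \<in> C\<close>, of "w t" "w 0"] by simp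
  qed
  then show ?thesis
    using \<open>0 < \<eta>\<close> by blast
qed

lemma open_strictly_above:
  fixes p :: "real^'n" and \<sigma> :: "'n \<Rightarrow> real"
  assumes "open W" "p \<in> W" and unit: "\<And>i. i \<in> C \<Longrightarrow> \<bar>\<sigma> i\<bar> = 1"
  shows "open {q \<in> W. \<forall>i\<in>C. \<sigma> i * p $ i < \<sigma> i * q $ i}"
    and "\<exists>q. q \<in> {q \<in> W. \<forall>i\<in>C. \<sigma> i * p $ i < \<sigma> i * q $ i}"
proof -
  let ?A = "{q \<in> W. \<forall>i\<in>C. \<sigma> i * p $ i < \<sigma> i * q $ i}"
  have "?A = W \<inter> (\<Inter>i\<in>C. {q. \<sigma> i * p $ i < \<sigma> i * q $ i})"
    by auto
  moreover have "open \<dots>"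
    using \<open>open W\<close> by (intro open_Int open_INT ballI open_Collect_less continuous_intros) auto
  ultimately show "open ?A"
    by simp
  define d :: "real^'n" where "d = (\<chi> i. \<sigma> i)"
  have "((\<lambda>h. p + h *\<^sub>R d) \<longlongrightarrow> p + 0 *\<^sub>R d) (at_right 0)"
    by (intro tendsto_intros)
  then have "\<forall>\<^sub>F h in at_right 0. p + h *\<^sub>R d \<in> W"
    using assms(1,2) by (intro topological_tendstoD[where l = p]) auto
  then have "\<forall>\<^sub>F h in at_right 0. p + h *\<^sub>R d \<in> W \<and> 0 < h"
    using eventually_at_right_less by (rule eventually_conj)
  then obtain h :: real where h: "p + h *\<^sub>R d \<in> W" "0 < h"
    using eventually_happens'[OF trivial_limit_at_right_real] by blast
  have "0 < \<sigma> i * (h * \<sigma> i)" if "i \<in> C" for i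
    using unit[OF that] h(2) by (auto simp: abs_if split: if_splits)
  then have "p + h *\<^sub>R d \<in> ?A"
    using h(1) by (simp add: d_def algebra_simps)
  then show "\<exists>q. q \<in> ?A"
    by (rule exI)
qed

theorem theorem2:
  fixes F :: "real^'n \<Rightarrow> real^'n" and X :: "(real^'n) set"
    and D :: "real \<Rightarrow> (real^'n) set" and \<Phi> :: "real \<Rightarrow> real^'n \<Rightarrow> real^'n"
  assumes "CARD('n) \<ge> 2"
    and "ode_system F X D \<Phi>"
    and "coherent F X"
  shows "\<forall>x\<in>X. nowhere_dense_in (top_of_set X) (orbit D \<Phi> x)"
proof (rule ballI, rule ccontr)
  fix x assume x: "x \<in> X" and somewhere: "\<not> nowhere_dense_in (top_of_set X) (orbit D \<Phi> x)"
  have conv: "convex X" and int: "X \<subseteq> closure (interior X)" and flow: "local_semiflow X D \<Phi>"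
    using assms(2) unfolding ode_system_def by blast+
  obtain U G where ext: "C1_extension F X U G"
    using assms(2) unfolding ode_system_def by blast
  define J where "J = {t. 0 \<le> t \<and> x \<in> D t}"
  define u where "u t = \<Phi> t x" for t
  have "solution_in F X x J u"
    using assms(2) x unfolding ode_system_def maximal_solution_in_def J_def u_def by blast
  then have J: "is_interval J" "0 \<in> J" "J \<subseteq> {0..}" and uX: "\<And>t. t \<in> J \<Longrightarrow> u t \<in> X"
    and deriv: "\<And>t. t \<in> J \<Longrightarrow> (u has_vector_derivative F (u t)) (at t within J)"
    unfolding solution_in_def by blast+
  have orbit: "orbit D \<Phi> x = u ` J"
    by (auto simp: orbit_def u_def J_def)
  have "u ` J \<subseteq> X"
    using uX by blast
  obtain W where W: "open W" "W \<noteq> {}" "W \<subseteq> X" "W \<subseteq> closure (u ` J)"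
  proof -
    obtain q where q: "q \<in> top_of_set X interior_of (top_of_set X closure_of (u ` J))"
      using somewhere \<open>u ` J \<subseteq> X\<close> unfolding nowhere_dense_in_def orbit by auto
    then obtain V where V: "open V" "q \<in> V" "q \<in> X" "X \<inter> V \<subseteq> X \<inter> closure (u ` J)"
      using \<open>u ` J \<subseteq> X\<close>
      unfolding interior_of_def closure_of_subtopology openin_open
      by (auto simp: inf_absorb2)
    have "V \<inter> interior X \<noteq> {}"
      using V int open_Int_closure_eq_empty[of V "interior X"] by blast
    then show ?thesis
      using V interior_subset[of X] by (intro that[of "V \<inter> interior X"]) auto
  qed
  have "{0..\<tau>} \<subseteq> J" if "\<tau> \<in> J" for \<tau>
    using J that unfolding is_interval_1 by (meson atLeastAtMost_iff subsetI)
  moreover have "u differentiable_on J"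
    using deriv unfolding differentiable_on_def
    by (meson differentiableI_vector)
  ultimately have tail: "W \<subseteq> closure (u ` (J \<inter> {\<tau>..}))" if "\<tau> \<in> J" for \<tau>
    using tail_dense_of_dense[of W u J \<tau>] W J(3) assms(1) that by simp
  have return: "\<exists>t\<in>J. \<tau> \<le> t \<and> u t \<in> V" if "\<tau> \<in> J" "open V" "p \<in> V" "p \<in> W" for \<tau> V p
    using dense_tail_meets[OF tail[OF that(1)] that(2,3,4)] by auto
  obtain p0 where "p0 \<in> W"
    using W(2) by blast
  have "J = {0..}"
    using global_if_tails_return[OF flow x _ J_def J(1)] return \<open>p0 \<in> W\<close> W(3)
    unfolding u_def by blast
  obtain C and \<sigma> :: "'n \<Rightarrow> real" where C: "C \<noteq> {}" "\<And>i. i \<in> C \<Longrightarrow> \<bar>\<sigma> i\<bar> = 1"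
    and off: "\<And>i j x. \<lbrakk>i \<in> C; j \<notin> C; x \<in> X\<rbrakk> \<Longrightarrow> partial_on F X i j x = 0"
    and coop: "\<And>i j x. \<lbrakk>i \<in> C; j \<in> C; j \<noteq> i; x \<in> X\<rbrakk> \<Longrightarrow> 0 \<le> \<sigma> i * \<sigma> j * partial_on F X i j x"
    using coherent_cooperative_block[OF assms(3)] by blast
  obtain t0 where t0: "0 \<le> t0" "u t0 \<in> W"
    using return[OF J(2) W(1) \<open>p0 \<in> W\<close> \<open>p0 \<in> W\<close>] by blast
  let ?A = "{q \<in> W. \<forall>i\<in>C. \<sigma> i * u t0 $ i < \<sigma> i * q $ i}"
  have "open ?A" "\<exists>q. q \<in> ?A"
    using open_strictly_above[of W "u t0" C \<sigma>] W(1) t0(2) C(2) by auto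
  then obtain q where q: "q \<in> ?A"
    by (elim exE)
  obtain t1 where t1: "t0 \<le> t1" "u t1 \<in> ?A"
    using return[of t0 ?A q] \<open>open ?A\<close> q t0(1) \<open>J = {0..}\<close> by auto
  \<comment> \<open>the solution through \<open>u t0\<close>, which is strictly larger on \<open>C\<close> at time \<open>T\<close> than at time \<open>0\<close>\<close>
  define w where "w t = u (t0 + t)" for t
  define T where "T = t1 - t0"
  have wT: "w T = u t1" and w0: "w 0 = u t0"
    by (simp_all add: w_def T_def)
  have "T \<noteq> 0"
    using t1(2) C(1) wT w0 by auto
  then have "0 < T"
    using t1(1) by (simp add: T_def)
  have shift: "u (a + t) \<in> X \<and> ((\<lambda>t. u (a + t)) has_vector_derivative G (u (a + t))) (at t within S)"
    if "0 \<le> a" "S \<subseteq> {0..}" "t \<in> S" for a t S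
  proof -
    have at: "a + t \<in> J" and sub: "(\<lambda>t. a + t) ` S \<subseteq> J"
      using that \<open>J = {0..}\<close> by auto
    have "((\<lambda>t. a + t) has_vector_derivative 1) (at t within S)"
      by (auto intro!: derivative_eq_intros)
    moreover have "(u has_vector_derivative F (u (a + t))) (at (a + t) within (\<lambda>t. a + t) ` S)"
      using deriv[OF at] sub has_vector_derivative_within_subset by blast
    ultimately have "(u \<circ> (\<lambda>t. a + t) has_vector_derivative 1 *\<^sub>R F (u (a + t))) (at t within S)"
      by (rule vector_diff_chain_within)
    then show ?thesis
      using uX[OF at] ext by (simp add: C1_extension_def comp_def)
  qed
  have mono: "\<sigma> i * w r $ i \<le> \<sigma> i * w (s + r) $ i"
    if "0 \<le> s" "0 \<le> r" "\<And>j. j \<in> C \<Longrightarrow> \<sigma> j * w 0 $ j \<le> \<sigma> j * w s $ j" "i \<in> C" for s r i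
    unfolding w_def add.assoc[symmetric]
  proof (rule cooperative_block_monotone[where C = C and X = X and U = U and G = G and T = r
        and x = "\<lambda>t. u (t0 + t)" and y = "\<lambda>t. u (t0 + s + t)" and t = r])
    show "partial_deriv G i j z = 0" if "i \<in> C" "j \<notin> C" "z \<in> X" for i j z
      using off[OF that] partial_on_eq[OF int ext that(3)] by simp
    show "0 \<le> \<sigma> i * \<sigma> j * partial_deriv G i j z" if "i \<in> C" "j \<in> C" "j \<noteq> i" "z \<in> X" for i j z
      using coop[OF that] partial_on_eq[OF int ext that(4)] by simp
    show "u (t0 + t) \<in> X \<and> ((\<lambda>t. u (t0 + t)) has_vector_derivative G (u (t0 + t))) (at t within {0..r})"
      "u (t0 + s + t) \<in> X \<and>
        ((\<lambda>t. u (t0 + s + t)) has_vector_derivative G (u (t0 + s + t))) (at t within {0..r})"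
      if "t \<in> {0..r}" for t
      using shift[of t0 "{0..r}" t] shift[of "t0 + s" "{0..r}" t] that t0(1) \<open>0 \<le> s\<close> by auto
    show "\<sigma> i * u (t0 + 0) $ i \<le> \<sigma> i * u (t0 + s + 0) $ i" if "i \<in> C" for i
      using \<open>\<And>j. j \<in> C \<Longrightarrow> \<sigma> j * w 0 $ j \<le> \<sigma> j * w s $ j\<close>[OF that] by (simp add: w_def)
  qed (use that ext conv C(2) in \<open>auto simp: C1_extension_def\<close>)
  have "\<exists>\<eta>>0. \<exists>t2. \<forall>t\<ge>t2. \<eta> \<le> dist (w t) (w 0)"
  proof (rule no_recurrence_after_increase)
    show "continuous_on {0..} w"
      unfolding w_def
      by (rule continuous_on_vector_derivative, rule shift[THEN conjunct2]) (use t0(1) in auto)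
    show "\<sigma> i * w 0 $ i < \<sigma> i * w T $ i" if "i \<in> C" for i
      using t1(2) that wT w0 by simp
  qed (fact \<open>0 < T\<close> C mono)+
  then obtain \<eta> t2 where away: "0 < \<eta>" "\<And>t. t2 \<le> t \<Longrightarrow> \<eta> \<le> dist (w t) (w 0)"
    by blast
  obtain t where "max 0 (t0 + t2) \<le> t" "u t \<in> ball (u t0) \<eta>"
    using return[of "max 0 (t0 + t2)" "ball (u t0) \<eta>" "u t0"] t0(2) away(1) \<open>J = {0..}\<close> by auto
  then show False
    using away(2)[of "t - t0"] by (simp add: w_def dist_commute)
qed

end
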